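(* Let $u_m^n$, $v_m^n$, $c_m^n$ be the solution of the following coupled discrete system, for $n=0,\dots,N-1$. The function $u$ solves $$u_m^{n+1}=\bar\Delta u_{m+1}^n+(1-2\bar\Delta)u_m^n+\bar\Delta u_{m-1}^n\ (1\le m\le M-1),\quad u_0^{n+1}=\widetilde\psi^{n+1},\quad u_M^{n+1}=(1-2\bar\Delta)u_M^n+2\bar\Delta u_{M-1}^n,$$ with $u_0^0=\widetilde\psi^0$, $u_m^0=0$ for $1\le m\le M$. The pair $(v,c)$ solves $$v_m^{n+1}=\bar\Delta(1+b_m^n)v_{m+1}^n+\bar\Delta(1-b_m^n)v_{m-1}^n+[1-2\bar\Delta+h_m^n]v_m^n+\bar\Delta b_m^nu_{m+1}^n+h_m^nu_m^n-\bar\Delta b_m^nu_{m-1}^n\ (1\le m\le M-1),$$ $$v_0^n=0,\qquad v_M^{n+1}=2\bar\Delta v_{M-1}^n+(1-2\bar\Delta+h_M^n)v_M^n+h_M^nu_M^n,$$ $$c_m^{n+1}=c_m^n\,e^{-\lambda\Delta_t(v_m^n+u_m^n)\varphi(c_m^n)}\ (1\le m\le M),$$ with $v_m^0=\bar s_0$, $c_m^0=\bar c_0$ for $1\le m\le M$, $0\le\bar s_0\le\widetilde\eta$, and $c_0^n=\bar c_0\exp(-\lambda\int_0^{t_n}\Psi_u\,du)$, where $$b_m^n=\frac{\varphi(c_{m+1}^n)-\varphi(c_{m-1}^n)}{4\varphi(c_m^n)},\qquad h_m^n=\lambda\Delta_tc_m^n\left(\varphi_2(v_m^n+u_m^n)-1\right).$$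 Suppose that $\bar\Delta\le1/2$ and that $$\bar c_0<\frac45\,\frac{\varphi_1}{|\varphi_2|},\qquad \Delta_t\le\frac{\Delta_x^2}{2+\lambda\bar c_0\Delta_x^2(1-\varphi_2\widetilde\eta)} .$$ Then there exist positive constants $C_{\Delta_x,T,\overline x}$ and $C_T$, not depending on $n$ or $\omega$, such that for any $n\in\{1,\dots,N\}$ and any $\omega\in\Omega$ the vector $V^n=(v_1^n,\dots,v_M^n)^T$ satisfies $$\|V^n(\omega)\|_{\Delta_x}\le C_{\Delta_x,T,\overline x}\,\widetilde\eta\qquad\text{and}\qquad\|V^n(\omega)\|_{\max}\le C_T\,\widetilde\eta .$$ The same stability results hold in mean: $\mathbb E\left[\|V^n\|_{\Delta_x}\right]\le C_{\Delta_x,T,\overline x}\,\widetilde\eta$ and $\mathbb E\left[\|V^n\|_{\max}\right]\le C_T\,\widetilde\eta$.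
   Context: Mesh: $T,\overline x>0$, $M,N\in\mathbb N$, $\Delta_x=\overline x/M$, $\Delta_t=T/N$, $\bar\Delta=\Delta_t/\Delta_x^2$, $t_n=n\Delta_t$. Norms: $\|V^n\|_{\Delta_x}=\left(\Delta_x\sum_{m=0}^M|v_m^n|^2\right)^{1/2}$ (with $v_0^n=0$) and $\|V^n\|_{\max}=\max_m|v_m^n|$. Parameters: $\alpha,\gamma,\sigma,\eta,\lambda,\bar c_0>0$, $\gamma<\eta$, $\min\left(\frac{2\alpha\gamma}{\sigma^2\eta},\frac{2\alpha(\eta-\gamma)}{\sigma^2\eta}\right)>1$; $\varphi(c)=\varphi_1+\varphi_2c$ with $\varphi_1>0$, $\varphi_2<0$; $\widetilde\eta=\eta/(\varphi_1+\bar c_0\varphi_2)$. Boundary data: $W$ is a Wiener process on the probability space $\Omega$ and $\Psi$ is the $[0,\eta]$-valued solution of $d\Psi_t=\alpha(\gamma-\Psi_t)dt+\sigma\sqrt{\Psi_t(\eta-\Psi_t)}\,dW_t$, $\Psi_0=\psi^0\in[0,\eta]$. Its discretization $\psi^n$ is given by $y^0=2\arcsin\sqrt{\psi^0/\eta}$ and, for $n=1,\dots,N$, $$y^n=y^{n-1}+f_{\Delta}(y^{n-1})\Delta_t+\sigma(W_{t_n}-W_{t_{n-1}}),\qquad \psi^n=\eta\sin^2(y^n/2),$$ so that $\psi^n\in[0,\eta]$, and $$\widetilde\psi^n=\frac{\psi^n}{\varphi\left(\bar c_0\exp\left(-\lambda\int_0^{t_n}\Psi_u\,du\right)\right)} .$$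 Here $f(y)=a_1\cot(y/2)-a_2\tan(y/2)$, $a_1=\frac{4\alpha\gamma-\sigma^2\eta}{4\eta}$, $a_2=\frac{4\alpha(\eta-\gamma)-\sigma^2\eta}{4\eta}$, $C_0=(2\alpha-\sigma^2)/4$, $y^*=2\arctan\sqrt{a_1/a_2}$, $k\in(0,1)$ is fixed, $\Delta=\Delta_t<\Delta^*:=\left(\min\{y^*,\pi-y^*,1\}\right)^{1/k}$, and, with $\epsilon=\Delta^k$, - $f_\Delta(y)=f(\epsilon)-\frac12\epsilon f'(\epsilon)-C_0(y-\frac12\epsilon)$ for $y<0$; - $f_\Delta(y)=f(\epsilon)+f'(\epsilon)(y-\epsilon)+\frac{1}{2\epsilon}(f'(\epsilon)+C_0)(y-\epsilon)^2$ for $0\le y<\epsilon$; - $f_\Delta(y)=f(y)$ for $\epsilon\le y\le\pi-\epsilon$; - $f_\Delta(y)=f(\pi-\epsilon)+f'(\pi-\epsilon)(y-\pi+\epsilon)-\frac{1}{2\epsilon}(f'(\pi-\epsilon)+C_0)(y-\pi+\epsilon)^2$ for $\pi-\epsilon<y\le\pi$; - $f_\Delta(y)=f(\pi-\epsilon)+\frac12\epsilon f'(\pi-\epsilon)-C_0(y-\pi+\frac12\epsilon)$ for $y>\pi$. *)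

theory Defs
  imports "HOL-Probability.Probability"
begin

section \<open>Wiener process, Ito integral and stochastic differential equations\<close>

text \<open>Time is real; of a filtration and of a process only the times in \<open>{0..}\<close> matter.\<close>

definition wiener_process ::
  "'w measure \<Rightarrow> (real \<Rightarrow> 'w measure) \<Rightarrow> (real \<Rightarrow> 'w \<Rightarrow> real) \<Rightarrow> bool" where
  "wiener_process P F W \<longleftrightarrow>
     (AE \<omega> in P. W 0 \<omega> = 0) \<and>
     (AE \<omega> in P. continuous_on {0..} (\<lambda>t. W t \<omega>)) \<and>
     (\<forall>t\<ge>0. W t \<in> borel_measurable (F t)) \<and>
     (\<forall>s t. 0 \<le> s \<and> s < t \<longrightarrow>
        distributed P lborel (\<lambda>\<omega>. W t \<omega> - W s \<omega>) (normal_density 0 (sqrt (t - s))) \<and>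
        prob_space.indep_set P (sets (F s))
          {(\<lambda>\<omega>. W t \<omega> - W s \<omega>) -` B \<inter> space P | B. B \<in> sets borel})"

text \<open>
  The data \<open>r\<close>, \<open>s\<close>, \<open>\<xi>\<close> describe the simple predictable process on \<open>{0..t}\<close>
  that equals \<open>\<xi> i\<close> on \<open>{s i<..s (Suc i)}\<close> for \<open>i < r\<close>, and \<open>0\<close> elsewhere.
\<close>

definition simple_process ::
  "(real \<Rightarrow> 'w measure) \<Rightarrow> real \<Rightarrow> nat \<Rightarrow> (nat \<Rightarrow> real) \<Rightarrow> (nat \<Rightarrow> 'w \<Rightarrow> real) \<Rightarrow> bool" where
  "simple_process F t r s \<xi> \<longleftrightarrow>
     0 \<le> s 0 \<and> s r \<le> t \<and> (\<forall>i<r. s i \<le> s (Suc i)) \<and>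
     (\<forall>i<r. \<xi> i \<in> borel_measurable (F (s i)) \<and> (\<exists>K. \<forall>\<omega>\<in>space (F (s i)). \<bar>\<xi> i \<omega>\<bar> \<le> K))"

definition simple_value ::
  "nat \<Rightarrow> (nat \<Rightarrow> real) \<Rightarrow> (nat \<Rightarrow> 'w \<Rightarrow> real) \<Rightarrow> real \<Rightarrow> 'w \<Rightarrow> real" where
  "simple_value r s \<xi> u \<omega> = (\<Sum>i<r. \<xi> i \<omega> * indicator {s i<..s (Suc i)} u)"

definition simple_integral ::
  "(real \<Rightarrow> 'w \<Rightarrow> real) \<Rightarrow> nat \<Rightarrow> (nat \<Rightarrow> real) \<Rightarrow> (nat \<Rightarrow> 'w \<Rightarrow> real) \<Rightarrow> 'w \<Rightarrow> real" where
  "simple_integral W r s \<xi> \<omega> = (\<Sum>i<r. \<xi> i \<omega> * (W (s (Suc i)) \<omega> - W (s i) \<omega>))"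

text \<open>
  \<open>has_ito_integral P F W H t I\<close>: the random variable \<open>I\<close> is (a version of) the Ito integral
  of the square-integrable process \<open>H\<close> against \<open>W\<close> over \<open>{0..t}\<close>, i.e. the mean-square limit
  of the integrals of simple processes that approximate \<open>H\<close> in mean square.
\<close>

definition has_ito_integral ::
  "'w measure \<Rightarrow> (real \<Rightarrow> 'w measure) \<Rightarrow> (real \<Rightarrow> 'w \<Rightarrow> real) \<Rightarrow> (real \<Rightarrow> 'w \<Rightarrow> real)
     \<Rightarrow> real \<Rightarrow> ('w \<Rightarrow> real) \<Rightarrow> bool" where
  "has_ito_integral P F W H t I \<longleftrightarrow>
     I \<in> borel_measurable P \<and>
     (\<exists>r s \<xi>. (\<forall>j::nat. simple_process F t (r j) (s j) (\<xi> j)) \<and>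
        ((\<lambda>j. \<integral>\<^sup>+\<omega>. (\<integral>\<^sup>+u\<in>{0..t}.
              ennreal ((H u \<omega> - simple_value (r j) (s j) (\<xi> j) u \<omega>)\<^sup>2) \<partial>lborel) \<partial>P)
           \<longlonglongrightarrow> 0) \<and>
        ((\<lambda>j. \<integral>\<^sup>+\<omega>. ennreal ((I \<omega> - simple_integral W (r j) (s j) (\<xi> j) \<omega>)\<^sup>2) \<partial>P)
           \<longlonglongrightarrow> 0))"

text \<open>
  \<open>X\<close> is a continuous adapted solution on \<open>{0..T}\<close> of
  \<open>dX = drift X dt + diff X dW\<close> with \<open>X 0 = x0\<close>.
\<close>

definition sde_solution ::
  "'w measure \<Rightarrow> (real \<Rightarrow> 'w measure) \<Rightarrow> (real \<Rightarrow> 'w \<Rightarrow> real) \<Rightarrow> real \<Rightarrow> (real \<Rightarrow> real)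
     \<Rightarrow> (real \<Rightarrow> real) \<Rightarrow> real \<Rightarrow> (real \<Rightarrow> 'w \<Rightarrow> real) \<Rightarrow> bool" where
  "sde_solution P F W T drift diff x0 X \<longleftrightarrow>
     (\<forall>t\<in>{0..T}. X t \<in> borel_measurable (F t)) \<and>
     (\<forall>\<omega>\<in>space P. continuous_on {0..T} (\<lambda>t. X t \<omega>)) \<and>
     (AE \<omega> in P. X 0 \<omega> = x0) \<and>
     (\<forall>t\<in>{0..T}. \<exists>I. has_ito_integral P F W (\<lambda>u \<omega>. diff (X u \<omega>)) t I \<and>
        (AE \<omega> in P. X t \<omega> = x0 + integral {0..t} (\<lambda>u. drift (X u \<omega>)) + I \<omega>))"


section \<open>Model parameters and mesh\<close>

locale sulphation_parameters =
  fixes \<alpha> \<gamma> \<sigma> \<eta> lam c0 \<phi>1 \<phi>2 k :: real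
  assumes positive: "0 < \<alpha>" "0 < \<gamma>" "0 < \<sigma>" "0 < \<eta>" "0 < lam" "0 < c0"
    and gamma_less: "\<gamma> < \<eta>"
    and boundary_unattainable:
      "min (2 * \<alpha> * \<gamma> / (\<sigma>\<^sup>2 * \<eta>)) (2 * \<alpha> * (\<eta> - \<gamma>) / (\<sigma>\<^sup>2 * \<eta>)) > 1"
    and phi_coeffs: "\<phi>1 > 0" "\<phi>2 < 0"
    and k_range: "0 < k" "k < 1"
begin

definition phi :: "real \<Rightarrow> real" where
  "phi c = \<phi>1 + \<phi>2 * c"

definition a1 :: real where
  "a1 = (4 * \<alpha> * \<gamma> - \<sigma>\<^sup>2 * \<eta>) / (4 * \<eta>)"

definition a2 :: real where
  "a2 = (4 * \<alpha> * (\<eta> - \<gamma>) - \<sigma>\<^sup>2 * \<eta>) / (4 * \<eta>)"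

definition C0 :: real where
  "C0 = (2 * \<alpha> - \<sigma>\<^sup>2) / 4"

definition y_star :: real where
  "y_star = 2 * arctan (sqrt (a1 / a2))"

definition f :: "real \<Rightarrow> real" where
  "f y = a1 * cot (y / 2) - a2 * tan (y / 2)"

definition \<Delta>_star :: real where
  "\<Delta>_star = Min {y_star, pi - y_star, 1} powr (1 / k)"

definition f_mod :: "real \<Rightarrow> real \<Rightarrow> real" where
  "f_mod \<Delta> y =
     (let \<epsilon> = \<Delta> powr k in
      if y < 0 then
        f \<epsilon> - 1/2 * \<epsilon> * deriv f \<epsilon> - C0 * (y - 1/2 * \<epsilon>)
      else if y < \<epsilon> then
        f \<epsilon> + deriv f \<epsilon> * (y - \<epsilon>) + 1 / (2 * \<epsilon>) * (deriv f \<epsilon> + C0) * (y - \<epsilon>)\<^sup>2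
      else if y \<le> pi - \<epsilon> then
        f y
      else if y \<le> pi then
        f (pi - \<epsilon>) + deriv f (pi - \<epsilon>) * (y - pi + \<epsilon>)
          - 1 / (2 * \<epsilon>) * (deriv f (pi - \<epsilon>) + C0) * (y - pi + \<epsilon>)\<^sup>2
      else
        f (pi - \<epsilon>) + 1/2 * \<epsilon> * deriv f (pi - \<epsilon>) - C0 * (y - pi + 1/2 * \<epsilon>))"

end

locale space_time_mesh =
  fixes T xbar :: real and M N :: nat
  assumes mesh_positive: "0 < T" "0 < xbar" "0 < M" "0 < N"
begin

definition dx :: real where
  "dx = xbar / real M"

definition dt :: real where
  "dt = T / real N"

definition mesh_ratio :: real where
  "mesh_ratio = dt / dx\<^sup>2"

definition time :: "nat \<Rightarrow> real" where
  "time n = real n * dt"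

end


section \<open>Stochastic boundary data\<close>

locale boundary_data =
  sulphation_parameters \<alpha> \<gamma> \<sigma> \<eta> lam c0 \<phi>1 \<phi>2 k + space_time_mesh T xbar M N + prob_space P
  for \<alpha> \<gamma> \<sigma> \<eta> lam c0 \<phi>1 \<phi>2 k T xbar :: real and M N :: nat and P :: "'w measure" +
  fixes F :: "real \<Rightarrow> 'w measure" and W \<Psi> :: "real \<Rightarrow> 'w \<Rightarrow> real" and \<psi>0 :: real
  assumes filtration: "filtration (space P) F" "\<And>t. subalgebra P (F t)"
    and wiener: "wiener_process P F W"
    and psi0_range: "0 \<le> \<psi>0" "\<psi>0 \<le> \<eta>"
    and Psi_range: "\<And>t \<omega>. t \<in> {0..T} \<Longrightarrow> \<omega> \<in> space P \<Longrightarrow> \<Psi> t \<omega> \<in> {0..\<eta>}"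
    and Psi_sde: "sde_solution P F W T (\<lambda>x. \<alpha> * (\<gamma> - x)) (\<lambda>x. \<sigma> * sqrt (x * (\<eta> - x))) \<psi>0 \<Psi>"
    and dt_less: "dt < \<Delta>_star"
begin

primrec y :: "nat \<Rightarrow> 'w \<Rightarrow> real" where
  "y 0 \<omega> = 2 * arcsin (sqrt (\<psi>0 / \<eta>))"
| "y (Suc n) \<omega> = y n \<omega> + f_mod dt (y n \<omega>) * dt + \<sigma> * (W (time (Suc n)) \<omega> - W (time n) \<omega>)"

definition \<psi> :: "nat \<Rightarrow> 'w \<Rightarrow> real" where
  "\<psi> n \<omega> = \<eta> * (sin (y n \<omega> / 2))\<^sup>2"

definition c_boundary :: "nat \<Rightarrow> 'w \<Rightarrow> real" where
  "c_boundary n \<omega> = c0 * exp (- lam * integral {0..time n} (\<lambda>s. \<Psi> s \<omega>))"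

definition psi_tilde :: "nat \<Rightarrow> 'w \<Rightarrow> real" where
  "psi_tilde n \<omega> = \<psi> n \<omega> / phi (c_boundary n \<omega>)"

end


section \<open>The coupled scheme\<close>

text \<open>
  \<open>u n \<omega> m\<close> is the value at time level \<open>n\<close>, sample point \<open>\<omega>\<close>, spatial node \<open>m\<close>, so that
  \<open>u n \<omega>\<close> is the spatial profile at level \<open>n\<close>; similarly for \<open>v\<close> and \<open>c\<close>.  Only
  \<open>n \<le> N\<close> and \<open>m \<le> M\<close> are meaningful.
\<close>

locale coupled_scheme =
  boundary_data \<alpha> \<gamma> \<sigma> \<eta> lam c0 \<phi>1 \<phi>2 k T xbar M N P F W \<Psi> \<psi>0
  for \<alpha> \<gamma> \<sigma> \<eta> lam c0 \<phi>1 \<phi>2 k T xbar :: real and M N :: nat and P :: "'w measure"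
    and F :: "real \<Rightarrow> 'w measure" and W \<Psi> :: "real \<Rightarrow> 'w \<Rightarrow> real" and \<psi>0 :: real +
  fixes s0 :: real and u v c :: "nat \<Rightarrow> 'w \<Rightarrow> nat \<Rightarrow> real"
    and b h :: "nat \<Rightarrow> 'w \<Rightarrow> nat \<Rightarrow> real"
  defines "b n \<omega> m \<equiv> (phi (c n \<omega> (m + 1)) - phi (c n \<omega> (m - 1))) / (4 * phi (c n \<omega> m))"
    and "h n \<omega> m \<equiv> lam * dt * c n \<omega> m * (\<phi>2 * (v n \<omega> m + u n \<omega> m) - 1)"
  assumes u_step:
      "\<And>n \<omega> m. n < N \<Longrightarrow> \<omega> \<in> space P \<Longrightarrow> 1 \<le> m \<Longrightarrow> m \<le> M - 1 \<Longrightarrow>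
        u (Suc n) \<omega> m = mesh_ratio * u n \<omega> (m + 1) + (1 - 2 * mesh_ratio) * u n \<omega> m
          + mesh_ratio * u n \<omega> (m - 1)"
    and u_left: "\<And>n \<omega>. n < N \<Longrightarrow> \<omega> \<in> space P \<Longrightarrow> u (Suc n) \<omega> 0 = psi_tilde (Suc n) \<omega>"
    and u_right:
      "\<And>n \<omega>. n < N \<Longrightarrow> \<omega> \<in> space P \<Longrightarrow>
        u (Suc n) \<omega> M = (1 - 2 * mesh_ratio) * u n \<omega> M + 2 * mesh_ratio * u n \<omega> (M - 1)"
    and u_init:
      "\<And>\<omega>. \<omega> \<in> space P \<Longrightarrow> u 0 \<omega> 0 = psi_tilde 0 \<omega>"
      "\<And>\<omega> m. \<omega> \<in> space P \<Longrightarrow> 1 \<le> m \<Longrightarrow> m \<le> M \<Longrightarrow> u 0 \<omega> m = 0"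
    and v_step:
      "\<And>n \<omega> m. n < N \<Longrightarrow> \<omega> \<in> space P \<Longrightarrow> 1 \<le> m \<Longrightarrow> m \<le> M - 1 \<Longrightarrow>
        v (Suc n) \<omega> m = mesh_ratio * (1 + b n \<omega> m) * v n \<omega> (m + 1)
          + mesh_ratio * (1 - b n \<omega> m) * v n \<omega> (m - 1)
          + (1 - 2 * mesh_ratio + h n \<omega> m) * v n \<omega> m
          + mesh_ratio * b n \<omega> m * u n \<omega> (m + 1) + h n \<omega> m * u n \<omega> m
          - mesh_ratio * b n \<omega> m * u n \<omega> (m - 1)"
    and v_left: "\<And>n \<omega>. n \<le> N \<Longrightarrow> \<omega> \<in> space P \<Longrightarrow> v n \<omega> 0 = 0"
    and v_right:
      "\<And>n \<omega>. n < N \<Longrightarrow> \<omega> \<in> space P \<Longrightarrow>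
        v (Suc n) \<omega> M = 2 * mesh_ratio * v n \<omega> (M - 1)
          + (1 - 2 * mesh_ratio + h n \<omega> M) * v n \<omega> M + h n \<omega> M * u n \<omega> M"
    and v_init: "\<And>\<omega> m. \<omega> \<in> space P \<Longrightarrow> 1 \<le> m \<Longrightarrow> m \<le> M \<Longrightarrow> v 0 \<omega> m = s0"
    and c_step:
      "\<And>n \<omega> m. n < N \<Longrightarrow> \<omega> \<in> space P \<Longrightarrow> 1 \<le> m \<Longrightarrow> m \<le> M \<Longrightarrow>
        c (Suc n) \<omega> m =
          c n \<omega> m * exp (- lam * dt * (v n \<omega> m + u n \<omega> m) * phi (c n \<omega> m))"
    and c_left: "\<And>n \<omega>. n \<le> N \<Longrightarrow> \<omega> \<in> space P \<Longrightarrow> c n \<omega> 0 = c_boundary n \<omega>"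
    and c_init: "\<And>\<omega> m. \<omega> \<in> space P \<Longrightarrow> 1 \<le> m \<Longrightarrow> m \<le> M \<Longrightarrow> c 0 \<omega> m = c0"


section \<open>Discrete norms\<close>

text \<open>The vector has the entries \<open>V m\<close> for \<open>m \<in> {1..M}\<close>, extended by \<open>V 0 = 0\<close>.\<close>

definition norm_dx :: "real \<Rightarrow> nat \<Rightarrow> (nat \<Rightarrow> real) \<Rightarrow> real" where
  "norm_dx \<delta> M V = sqrt (\<delta> * (\<Sum>m=0..M. \<bar>V m\<bar>\<^sup>2))"

definition norm_max :: "nat \<Rightarrow> (nat \<Rightarrow> real) \<Rightarrow> real" where
  "norm_max M V = Max ((\<lambda>m. \<bar>V m\<bar>) ` {1..M})"

end

theory Submission
  imports Defs
begin

text \<open>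
  The sum \<open>s = u + v\<close> satisfies a homogeneous explicit scheme with coefficients
  \<open>mesh_ratio * (1 + b)\<close>, \<open>mesh_ratio * (1 - b)\<close> and \<open>1 - 2 * mesh_ratio + h\<close>.  As long as
  \<open>0 < c \<le> c0\<close> and \<open>0 \<le> s \<le> eta_tilde\<close>, the bound on \<open>c0\<close> gives \<open>\<bar>b\<bar> \<le> 1\<close> and the time step
  restriction makes the third coefficient nonnegative, while \<open>h \<le> 0\<close>.  Hence the coefficients
  are nonnegative with sum at most \<open>1\<close>, and these bounds, together with \<open>0 \<le> u \<le> eta_tilde\<close>,
  propagate in time.  So \<open>\<bar>v\<bar> \<le> eta_tilde\<close>, and one can take \<open>C_T = 1\<close> and
  \<open>C = sqrt xbar\<close>.
\<close>

section \<open>Weighted averages and integrals of random paths\<close>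

text \<open>Membership of \<open>x\<close> in \<open>{0..E}\<close> forces \<open>0 \<le> E\<close>,
  so a total weight below 1 only lowers the upper bound. Applied node by node, this is the discrete
  maximum principle.\<close>

lemma subconvex_combination_bounds:
  fixes p q r x y z E :: real
  assumes "0 \<le> p" "0 \<le> q" "0 \<le> r" "p + q + r \<le> 1"
    and "x \<in> {0..E}" "y \<in> {0..E}" "z \<in> {0..E}"
  shows "p * x + q * y + r * z \<in> {0..E}"
proof -
  have "p * x + q * y + r * z \<le> p * E + q * E + r * E"
    using assms by (intro add_mono mult_left_mono) auto
  also have "\<dots> = (p + q + r) * E" by (simp add: algebra_simps)
  also have "\<dots> \<le> 1 * E" using assms by (intro mult_right_mono) auto
  finally show ?thesis using assms by simp
qed

text \<open>Path continuity upgrades measurability at each fixed time to joint measurability in time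
  and sample point; integrating out the time then leaves a measurable function.\<close>

lemma borel_measurable_integral_continuous_paths:
  fixes X :: "real \<Rightarrow> 'w \<Rightarrow> real"
  assumes meas: "\<And>s. s \<in> {a..b} \<Longrightarrow> X s \<in> borel_measurable P"
    and cont: "\<And>\<omega>. \<omega> \<in> space P \<Longrightarrow> continuous_on {a..b} (\<lambda>s. X s \<omega>)"
  shows "(\<lambda>\<omega>. integral {a..b} (\<lambda>s. X s \<omega>)) \<in> borel_measurable P"
proof (cases "a \<le> b")
  case False
  then show ?thesis by simp
next
  case True
  \<comment> \<open>Clamping the time extends the paths continuously to the whole line, so grid
    points outside \<open>{a..b}\<close> do no harm.\<close>
  define Y where "Y s \<omega> = X (max a (min b s)) \<omega>" for s \<omega>
  have clamp: "max a (min b s) \<in> {a..b}" for s using True by auto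
  have Y_cont: "continuous_on UNIV (\<lambda>s. Y s \<omega>)" if "\<omega> \<in> space P" for \<omega>
    unfolding Y_def
    by (rule continuous_on_compose2[OF cont[OF that], where f = "\<lambda>s. max a (min b s)"])
      (use clamp in \<open>auto intro!: continuous_intros\<close>)
  \<comment> \<open>Time rounded down to the grid of width \<open>1 / n\<close> takes countably many
    values, and each of them gives a measurable section. For \<open>n = 0\<close> the rounded time
    is 0, which does not affect the limit.\<close>
  have step: "(\<lambda>x. Y (real_of_int \<lfloor>real n * fst x\<rfloor> / real n) (snd x))
      \<in> borel_measurable (lborel \<Otimes>\<^sub>M P)" for n
  proof (rule measurable_compose_countable[where
        g = "\<lambda>x. \<lfloor>real n * fst x\<rfloor>" and f = "\<lambda>i x. Y (real_of_int i / real n) (snd x)"])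
    show "(\<lambda>x. Y (real_of_int i / real n) (snd x)) \<in> borel_measurable (lborel \<Otimes>\<^sub>M P)" for i
      unfolding Y_def by (rule measurable_compose[OF measurable_snd meas[OF clamp]])
    show "(\<lambda>x. \<lfloor>real n * fst x\<rfloor>) \<in> lborel \<Otimes>\<^sub>M P \<rightarrow>\<^sub>M count_space UNIV"
      by measurable
  qed
  have joint: "(\<lambda>x. Y (fst x) (snd x)) \<in> borel_measurable (lborel \<Otimes>\<^sub>M P)"
  proof (rule borel_measurable_LIMSEQ_real[OF _ step])
    fix x :: "real \<times> 'w" assume x: "x \<in> space (lborel \<Otimes>\<^sub>M P)"
    have "(\<lambda>n. real_of_int \<lfloor>real n * fst x\<rfloor> / real n) \<longlonglongrightarrow> fst x"
    proof (rule LIMSEQ_I)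
      fix e :: real assume e: "0 < e"
      obtain n0 where n0: "1 / e < real n0" using reals_Archimedean2 by blast
      show "\<exists>n0. \<forall>n\<ge>n0. norm (real_of_int \<lfloor>real n * fst x\<rfloor> / real n - fst x) < e"
      proof (intro exI allI impI)
        fix n assume n: "n0 \<le> n"
        have ne: "1 / e < real n" using n n0 by linarith
        have pos: "0 < real n" using ne e by (meson less_trans zero_less_divide_1_iff)
        have "real_of_int \<lfloor>real n * fst x\<rfloor> / real n - fst x
            = (real_of_int \<lfloor>real n * fst x\<rfloor> - real n * fst x) / real n"
          using pos by (simp add: field_simps)
        moreover have "\<bar>real_of_int \<lfloor>real n * fst x\<rfloor> - real n * fst x\<bar> < 1" by linarith
        ultimately have "norm (real_of_int \<lfloor>real n * fst x\<rfloor> / real n - fst x) < 1 / real n"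
          using pos by (simp add: divide_strict_right_mono)
        also have "1 / real n < e" using ne pos e by (simp add: field_simps)
        finally show "norm (real_of_int \<lfloor>real n * fst x\<rfloor> / real n - fst x) < e" .
      qed
    qed
    moreover have "isCont (\<lambda>s. Y s (snd x)) (fst x)"
      using Y_cont[of "snd x"] x
      by (auto simp: space_pair_measure continuous_on_eq_continuous_at)
    ultimately show "(\<lambda>n. Y (real_of_int \<lfloor>real n * fst x\<rfloor> / real n) (snd x))
        \<longlonglongrightarrow> Y (fst x) (snd x)"
      using isCont_tendsto_compose by blast
  qed
  have swap: "(\<lambda>z. Y (snd z) (fst z)) \<in> borel_measurable (P \<Otimes>\<^sub>M lborel)"
    using measurable_compose[OF measurable_pair_swap' joint] by (simp add: split_beta)
  have "(\<lambda>\<omega>. LINT s|lborel. indicator {a..b} s *\<^sub>R Y s \<omega>) \<in> borel_measurable P"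
    using swap by (intro lborel.borel_measurable_lebesgue_integral) (simp add: split_beta)
  \<comment> \<open>For continuous paths the Lebesgue and gauge integrals agree, and clamping
    changes nothing on \<open>{a..b}\<close>.\<close>
  moreover have "(LINT s|lborel. indicator {a..b} s *\<^sub>R Y s \<omega>)
      = integral {a..b} (\<lambda>s. X s \<omega>)" if "\<omega> \<in> space P" for \<omega>
  proof -
    have "set_integrable lborel {a..b} (\<lambda>s. Y s \<omega>)"
      by (rule borel_integrable_atLeastAtMost')
        (rule continuous_on_subset[OF Y_cont[OF that] subset_UNIV])
    then have "(LINT s|lborel. indicator {a..b} s *\<^sub>R Y s \<omega>) = integral {a..b} (\<lambda>s. Y s \<omega>)"
      by (rule set_borel_integral_eq_integral(2)[unfolded set_lebesgue_integral_def])
    also have "\<dots> = integral {a..b} (\<lambda>s. X s \<omega>)"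
      by (rule integral_cong) (simp add: Y_def)
    finally show ?thesis .
  qed
  ultimately show ?thesis by (simp cong: measurable_cong)
qed

section \<open>Bounds and measurability of the discrete norms\<close>

lemma norm_max_le:
  assumes "0 < M" "\<And>m. 1 \<le> m \<Longrightarrow> m \<le> M \<Longrightarrow> \<bar>V m\<bar> \<le> K"
  shows "norm_max M V \<le> K"
  unfolding norm_max_def using assms by (subst Max_le_iff) auto

lemma norm_max_nonneg: "0 < M \<Longrightarrow> 0 \<le> norm_max M V"
  unfolding norm_max_def by (subst Max_ge_iff) auto

lemma norm_dx_le:
  assumes "0 \<le> \<delta>" "0 \<le> K" "V 0 = 0" "\<And>m. 1 \<le> m \<Longrightarrow> m \<le> M \<Longrightarrow> \<bar>V m\<bar> \<le> K"
  shows "norm_dx \<delta> M V \<le> sqrt (\<delta> * real M) * K"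
proof -
  \<comment> \<open>Since \<open>V 0 = 0\<close>, only \<open>M\<close> terms remain; this yields
    the factor \<open>real M\<close> rather than \<open>real M + 1\<close>.\<close>
  have "(\<Sum>m=0..M. \<bar>V m\<bar>\<^sup>2) = (\<Sum>m=1..M. \<bar>V m\<bar>\<^sup>2)"
    using assms(3) by (simp add: sum.atLeast_Suc_atMost)
  also have "\<dots> \<le> (\<Sum>m=1..M. K\<^sup>2)"
    using assms(4) by (intro sum_mono power_mono) auto
  finally have "\<delta> * (\<Sum>m=0..M. \<bar>V m\<bar>\<^sup>2) \<le> \<delta> * real M * K\<^sup>2"
    using assms(1) by (simp add: mult_left_mono mult.assoc)
  then show ?thesis
    unfolding norm_dx_def using real_sqrt_le_mono[of _ "\<delta> * real M * K\<^sup>2"] assms(2)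
    by (fastforce simp: real_sqrt_mult)
qed

lemma borel_measurable_norm_dx:
  assumes "\<And>m. m \<le> M \<Longrightarrow> (\<lambda>\<omega>. V \<omega> m) \<in> borel_measurable P"
  shows "(\<lambda>\<omega>. norm_dx \<delta> M (V \<omega>)) \<in> borel_measurable P"
  unfolding norm_dx_def using assms by measurable

lemma borel_measurable_norm_max:
  assumes "\<And>m. m \<le> M \<Longrightarrow> (\<lambda>\<omega>. V \<omega> m) \<in> borel_measurable P"
  shows "(\<lambda>\<omega>. norm_max M (V \<omega>)) \<in> borel_measurable P"
  unfolding norm_max_def using assms by (intro borel_measurable_Max) auto

section \<open>Porosity function and modified drift\<close>

context sulphation_parameters
begin

text \<open>The denominator is \<open>phi c0\<close>, the least value of \<open>phi\<close> on
  \<open>{0..c0}\<close>.\<close>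

definition eta_tilde :: real where
  "eta_tilde = \<eta> / (\<phi>1 + c0 * \<phi>2)"

text \<open>\<open>phi\<close> is decreasing, and the hypothesis on \<open>c0\<close> says that it
  loses less than \<open>4 / 5 * \<phi>1\<close> over \<open>{0..c0}\<close>.\<close>

lemma phi_bounds:
  assumes "c0 < 4 / 5 * (\<phi>1 / \<bar>\<phi>2\<bar>)" and "x \<in> {0..c0}"
  shows "\<phi>1 / 5 < phi x" "phi c0 \<le> phi x" "phi x \<le> \<phi>1"
proof -
  have "c0 * - \<phi>2 < 4 / 5 * \<phi>1"
    using assms(1) phi_coeffs by (simp add: field_simps)
  moreover have "x * - \<phi>2 \<le> c0 * - \<phi>2" "0 \<le> x * - \<phi>2"
    using assms(2) phi_coeffs by (auto intro!: mult_right_mono_neg mult_nonneg_nonpos)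
  ultimately show "\<phi>1 / 5 < phi x" "phi c0 \<le> phi x" "phi x \<le> \<phi>1"
    unfolding phi_def by (simp_all add: mult.commute)
qed

text \<open>\<open>f\<close> is built from quotients of sine and cosine; division is total and Borel
  measurable, so the poles are harmless. The values of \<open>deriv f\<close> enter only as
  constants.\<close>

lemma borel_measurable_f_mod: "f_mod \<Delta> \<in> borel_measurable borel"
proof -
  have [measurable]: "f \<in> borel_measurable borel"
    unfolding f_def tan_def cot_def by measurable
  show ?thesis unfolding f_mod_def Let_def by measurable
qed

end

section \<open>Measurability and range of the boundary values\<close>

context boundary_data
begin

lemma time_range: "n \<le> N \<Longrightarrow> time n \<in> {0..T}"
  using mesh_positive unfolding time_def dt_def by (auto simp: field_simps)

lemma dt_pos: "0 < dt" and dx_pos: "0 < dx"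
  using mesh_positive by (auto simp: dt_def dx_def)

lemma borel_measurable_filtered: "X \<in> borel_measurable (F t) \<Longrightarrow> X \<in> borel_measurable P"
  using filtration(2) measurable_from_subalg by blast

lemma borel_measurable_W: "0 \<le> t \<Longrightarrow> W t \<in> borel_measurable P"
  using wiener borel_measurable_filtered unfolding wiener_process_def by blast

lemma borel_measurable_y: "y n \<in> borel_measurable P"
proof (induction n)
  case (Suc n)
  have [measurable]: "W (time n) \<in> borel_measurable P" "W (time (Suc n)) \<in> borel_measurable P"
    using dt_pos by (auto intro!: borel_measurable_W simp: time_def)
  note [measurable] = Suc borel_measurable_f_mod
  show ?case unfolding y.simps(2)[abs_def] by measurable
qed (simp add: y.simps(1)[abs_def])

lemma Psi_continuous_on:
  "n \<le> N \<Longrightarrow> \<omega> \<in> space P \<Longrightarrow> continuous_on {0..time n} (\<lambda>s. \<Psi> s \<omega>)"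
  using Psi_sde time_range[of n] unfolding sde_solution_def
  by (auto intro: continuous_on_subset[where s = "{0..T}"])

lemma borel_measurable_c_boundary:
  assumes "n \<le> N"
  shows "c_boundary n \<in> borel_measurable P"
proof -
  have "\<Psi> s \<in> borel_measurable P" if "s \<in> {0..time n}" for s
  proof (rule borel_measurable_filtered)
    show "\<Psi> s \<in> borel_measurable (F s)"
      using that time_range[OF assms] Psi_sde unfolding sde_solution_def by auto
  qed
  then have [measurable]:
      "(\<lambda>\<omega>. integral {0..time n} (\<lambda>s. \<Psi> s \<omega>)) \<in> borel_measurable P"
    using Psi_continuous_on[OF assms] by (rule borel_measurable_integral_continuous_paths)
  show ?thesis unfolding c_boundary_def[abs_def] by measurable
qed

lemma borel_measurable_psi_tilde:
  assumes "n \<le> N"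
  shows "psi_tilde n \<in> borel_measurable P"
proof -
  note [measurable] = borel_measurable_y borel_measurable_c_boundary[OF assms]
  show ?thesis unfolding psi_tilde_def[abs_def] \<psi>_def phi_def by measurable
qed

text \<open>As \<open>\<Psi>\<close> is nonnegative, the exponent is nonpositive.\<close>

lemma c_boundary_range:
  assumes "n \<le> N" "\<omega> \<in> space P"
  shows "c_boundary n \<omega> \<in> {0<..c0}"
proof -
  have "0 \<le> integral {0..time n} (\<lambda>s. \<Psi> s \<omega>)"
    using Psi_continuous_on[OF assms] Psi_range assms(2) time_range[OF assms(1)]
    by (intro integral_nonneg integrable_continuous_real) auto
  then show ?thesis using positive unfolding c_boundary_def by auto
qed

text \<open>The numerator is \<open>\<eta>\<close> times a squared sine, and the denominator is at
  least \<open>phi c0 > 0\<close>.\<close>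

lemma psi_tilde_range:
  assumes "c0 < 4 / 5 * (\<phi>1 / \<bar>\<phi>2\<bar>)" "n \<le> N" "\<omega> \<in> space P"
  shows "psi_tilde n \<omega> \<in> {0..eta_tilde}"
proof -
  have psi: "0 \<le> \<psi> n \<omega>" "\<psi> n \<omega> \<le> \<eta>"
    using positive by (auto simp: \<psi>_def abs_square_le_1 mult_le_cancel_left2)
  have "0 < phi c0" using phi_bounds(1)[OF assms(1), of c0] positive phi_coeffs by auto
  moreover have "phi c0 \<le> phi (c_boundary n \<omega>)"
    using phi_bounds(2)[OF assms(1)] c_boundary_range[OF assms(2,3)] by auto
  ultimately show ?thesis
    using psi frac_le[of \<eta> "\<psi> n \<omega>" "phi c0" "phi (c_boundary n \<omega>)"]
    unfolding psi_tilde_def eta_tilde_def by (auto simp: phi_def mult.commute)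
qed

end

section \<open>Measurability of the discrete solution\<close>

context coupled_scheme
begin

text \<open>The means of the norms require this. All nodes and all three unknowns share one
  induction, because an update reads neighbouring nodes and mixes \<open>u\<close>, \<open>v\<close>
  and \<open>c\<close>.\<close>

lemma borel_measurable_scheme:
  assumes "n \<le> N"
  shows "\<forall>m\<le>M. (\<lambda>\<omega>. u n \<omega> m) \<in> borel_measurable P \<and> (\<lambda>\<omega>. v n \<omega> m) \<in> borel_measurable P
    \<and> (\<lambda>\<omega>. c n \<omega> m) \<in> borel_measurable P"
  using assms
proof (induction n)
  case 0
  \<comment> \<open>The equations of the scheme hold only on \<open>space P\<close>, so they are
    applied through \<open>measurable_cong\<close>, here and below.\<close>
  have left: "(\<lambda>\<omega>. u 0 \<omega> 0) \<in> borel_measurable P" "(\<lambda>\<omega>. v 0 \<omega> 0) \<in> borel_measurable P"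
    "(\<lambda>\<omega>. c 0 \<omega> 0) \<in> borel_measurable P"
    using borel_measurable_psi_tilde[of 0] borel_measurable_c_boundary[of 0]
    by (simp_all add: u_init v_left c_left cong: measurable_cong)
  have interior: "(\<lambda>\<omega>. u 0 \<omega> m) \<in> borel_measurable P" "(\<lambda>\<omega>. v 0 \<omega> m) \<in> borel_measurable P"
    "(\<lambda>\<omega>. c 0 \<omega> m) \<in> borel_measurable P" if "1 \<le> m" "m \<le> M" for m
    using that by (simp_all add: u_init v_init c_init cong: measurable_cong)
  show ?case
    using left interior by (metis less_one not_le)
next
  case (Suc n)
  have n: "n < N" using Suc.prems by simp
  have IH: "(\<lambda>\<omega>. u n \<omega> m) \<in> borel_measurable P" "(\<lambda>\<omega>. v n \<omega> m) \<in> borel_measurable P"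
    "(\<lambda>\<omega>. c n \<omega> m) \<in> borel_measurable P" if "m \<le> M" for m
    using Suc that by simp_all
  show ?case
  proof (intro allI impI)
    fix m assume m: "m \<le> M"
    note [measurable] = IH[OF m]
    \<comment> \<open>For \<open>M = 1\<close> the interior case is empty.\<close>
    consider "m = 0" | "1 \<le> m" "m \<le> M - 1" | "m = M" "1 \<le> m" using m by linarith
    then show "(\<lambda>\<omega>. u (Suc n) \<omega> m) \<in> borel_measurable P
      \<and> (\<lambda>\<omega>. v (Suc n) \<omega> m) \<in> borel_measurable P
      \<and> (\<lambda>\<omega>. c (Suc n) \<omega> m) \<in> borel_measurable P"
    proof cases
      case 1
      show ?thesis
        using borel_measurable_psi_tilde[OF Suc.prems] borel_measurable_c_boundary[OF Suc.prems]
        by (simp add: 1 measurable_cong[OF u_left[OF n]] measurable_cong[OF v_left[OF Suc.prems]]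
          measurable_cong[OF c_left[OF Suc.prems]])
    next
      case 2
      then have "m + 1 \<le> M" "m - 1 \<le> M" using mesh_positive by auto
      note [measurable] = IH[OF this(1)] IH[OF this(2)]
      show ?thesis
        by (simp only: measurable_cong[OF u_step[OF n _ 2]] measurable_cong[OF v_step[OF n _ 2]]
          measurable_cong[OF c_step[OF n _ 2(1) m]] b_def h_def phi_def) (intro conjI; measurable)
    next
      case 3
      have "M - 1 \<le> M" by simp
      note [measurable] = IH[OF this]
      note [measurable] = IH[OF order_refl]
      show ?thesis
        by (simp only: 3(1) measurable_cong[OF u_right[OF n]] measurable_cong[OF v_right[OF n]]
          measurable_cong[OF c_step[OF n _ 3(2)[unfolded 3(1)] order_refl]] h_def phi_def) (intro conjI; measurable)
    qed
  qed
qed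

section \<open>Invariant region of the scheme\<close>

context
  assumes s0_range: "s0 \<in> {0..eta_tilde}"
    and ratio_le: "mesh_ratio \<le> 1 / 2"
    and c0_less: "c0 < 4 / 5 * (\<phi>1 / \<bar>\<phi>2\<bar>)"
    and dt_le: "dt \<le> dx\<^sup>2 / (2 + lam * c0 * dx\<^sup>2 * (1 - \<phi>2 * eta_tilde))"
begin

lemma eta_tilde_nonneg: "0 \<le> eta_tilde"
  using s0_range by simp

lemma mesh_ratio_pos: "0 < mesh_ratio"
  using dt_pos dx_pos by (simp add: mesh_ratio_def)

text \<open>Clearing the positive denominator in \<open>dt_le\<close> gives this form: the diagonal
  weight \<open>1 - 2 * mesh_ratio + h\<close> is nonnegative in the worst case
  \<open>c = c0\<close>, \<open>v + u = eta_tilde\<close>.\<close>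

lemma time_step_restriction:
  "2 * mesh_ratio + lam * dt * c0 * (1 - \<phi>2 * eta_tilde) \<le> 1"
proof -
  define K where "K = lam * c0 * (1 - \<phi>2 * eta_tilde)"
  have "0 \<le> 1 - \<phi>2 * eta_tilde"
    using phi_coeffs eta_tilde_nonneg mult_nonpos_nonneg[of \<phi>2 eta_tilde] by simp
  then have "0 \<le> K * dx\<^sup>2" unfolding K_def using positive by simp
  then have "dt * (2 + K * dx\<^sup>2) \<le> dx\<^sup>2"
    using dt_le by (simp add: K_def pos_le_divide_eq mult_ac)
  then have "dt * (2 + K * dx\<^sup>2) / dx\<^sup>2 \<le> 1"
    using dx_pos by simp
  moreover have "dt * (2 + K * dx\<^sup>2) / dx\<^sup>2 = 2 * mesh_ratio + dt * K"
    using dx_pos by (simp add: mesh_ratio_def field_simps)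
  ultimately show ?thesis by (simp add: K_def mult_ac)
qed

text \<open>The three ranges need each other: the bounds on \<open>v + u\<close> and
  \<open>c\<close> control \<open>h\<close>, those on \<open>c\<close> control \<open>b\<close>, and
  \<open>0 \<le> v + u\<close> makes \<open>c\<close> nonincreasing in time. The separate bound on
  \<open>u\<close> later recovers \<open>v\<close>.\<close>

lemma scheme_range:
  assumes \<omega>: "\<omega> \<in> space P"
  shows "n \<le> N \<Longrightarrow> m \<le> M \<Longrightarrow>
    u n \<omega> m \<in> {0..eta_tilde} \<and> v n \<omega> m + u n \<omega> m \<in> {0..eta_tilde} \<and> c n \<omega> m \<in> {0<..c0}"
proof (induction n arbitrary: m)
  case 0
  show ?case
  proof (cases "m = 0")
    case True
    then show ?thesis
      using psi_tilde_range[OF c0_less 0(1) \<omega>] c_boundary_range[OF 0(1) \<omega>]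
        v_left[OF 0(1) \<omega>] c_left[OF 0(1) \<omega>] u_init(1)[OF \<omega>] by simp
  next
    case False
    then show ?thesis
      using 0(2) s0_range positive u_init(2)[OF \<omega>] v_init[OF \<omega>] c_init[OF \<omega>] by simp
  qed
next
  case (Suc n)
  have n: "n < N" using Suc.prems by simp
  have IH: "u n \<omega> j \<in> {0..eta_tilde}" "v n \<omega> j + u n \<omega> j \<in> {0..eta_tilde}" "c n \<omega> j \<in> {0<..c0}"
    if "j \<le> M" for j
    using Suc.IH[OF _ that] n by simp_all
  have phi: "\<phi>1 / 5 < phi (c n \<omega> j)" "phi (c n \<omega> j) \<le> \<phi>1" if "j \<le> M" for j
    using phi_bounds[OF c0_less] IH(3)[OF that] by simp_all
  \<comment> \<open>As \<open>\<phi>2 < 0\<close>, \<open>- h\<close> is nonnegative and increases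
    with both \<open>c\<close> and \<open>v + u\<close>, so its maximum is the term bounded in
    \<open>time_step_restriction\<close>.\<close>
  have h_le: "h n \<omega> j \<le> 0" and h_ge: "2 * mesh_ratio - h n \<omega> j \<le> 1" if "j \<le> M" for j
  proof -
    define s where "s = v n \<omega> j + u n \<omega> j"
    have s: "0 \<le> s" "s \<le> eta_tilde" using IH(2)[OF that] by (simp_all add: s_def)
    have "\<phi>2 * eta_tilde \<le> \<phi>2 * s" using s phi_coeffs by (simp add: mult_left_mono_neg)
    moreover have "\<phi>2 * s \<le> 0" using s phi_coeffs by (simp add: mult_nonpos_nonneg)
    ultimately have "c n \<omega> j * (1 - \<phi>2 * s) \<le> c0 * (1 - \<phi>2 * eta_tilde)"
        "0 \<le> c n \<omega> j * (1 - \<phi>2 * s)"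
      using IH(3)[OF that] positive by (auto intro!: mult_mono)
    then have "lam * dt * (c n \<omega> j * (1 - \<phi>2 * s)) \<le> lam * dt * (c0 * (1 - \<phi>2 * eta_tilde))"
        "0 \<le> lam * dt * (c n \<omega> j * (1 - \<phi>2 * s))"
      using positive dt_pos by (auto intro: mult_left_mono)
    moreover have "h n \<omega> j = - (lam * dt * (c n \<omega> j * (1 - \<phi>2 * s)))"
      unfolding h_def s_def[symmetric] by (simp add: algebra_simps)
    ultimately show "h n \<omega> j \<le> 0" "2 * mesh_ratio - h n \<omega> j \<le> 1"
      using time_step_restriction by (simp_all add: mult.assoc)
  qed
  have c: "c (Suc n) \<omega> m \<in> {0<..c0}" if "1 \<le> m"
  proof -
    have "0 \<le> lam * dt * (v n \<omega> m + u n \<omega> m) * phi (c n \<omega> m)"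
      using IH(2)[OF Suc.prems(2)] phi(1)[OF Suc.prems(2)] positive dt_pos phi_coeffs
      by (intro mult_nonneg_nonneg) auto
    then have "exp (- lam * dt * (v n \<omega> m + u n \<omega> m) * phi (c n \<omega> m)) \<le> 1"
      by simp
    then show ?thesis
      using IH(3)[OF Suc.prems(2)] that Suc.prems(2)
        mult_mono[of "c n \<omega> m" c0 "exp (- lam * dt * (v n \<omega> m + u n \<omega> m) * phi (c n \<omega> m))" 1]
      by (simp add: c_step[OF n \<omega>])
  qed
  note ratio = mesh_ratio_pos ratio_le
  consider "m = 0" | "1 \<le> m" "m \<le> M - 1" | "m = M" "1 \<le> m" using Suc.prems(2) by linarith
  then show ?case
  proof cases
    case 1
    then show ?thesis
      using psi_tilde_range[OF c0_less Suc.prems(1) \<omega>] c_boundary_range[OF Suc.prems(1) \<omega>]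
        v_left[OF Suc.prems(1) \<omega>] c_left[OF Suc.prems(1) \<omega>] u_left[OF n \<omega>] by simp
  next
    case 2
    then have j: "m + 1 \<le> M" "m \<le> M" "m - 1 \<le> M" using mesh_positive by auto
    \<comment> \<open>Both neighbouring values lie between \<open>\<phi>1 / 5\<close> and
      \<open>\<phi>1\<close>, so they differ by less than \<open>4 / 5 * \<phi>1\<close>, which is
      below the right-hand side.\<close>
    have "\<bar>phi (c n \<omega> (m + 1)) - phi (c n \<omega> (m - 1))\<bar> \<le> 4 * phi (c n \<omega> m)"
      using phi[OF j(1)] phi[OF j(2)] phi[OF j(3)] by (simp add: abs_le_iff)
    then have "\<bar>b n \<omega> m\<bar> \<le> 1"
      using phi(1)[OF j(2)] phi_coeffs unfolding b_def by simp
    then have p: "0 \<le> mesh_ratio * (1 + b n \<omega> m)" "0 \<le> mesh_ratio * (1 - b n \<omega> m)"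
      using ratio by (auto intro!: mult_nonneg_nonneg)
    have "u (Suc n) \<omega> m \<in> {0..eta_tilde}"
      using subconvex_combination_bounds[OF _ _ _ _ IH(1)[OF j(1)] IH(1)[OF j(2)] IH(1)[OF j(3)],
          of mesh_ratio "1 - 2 * mesh_ratio" mesh_ratio] ratio
      by (simp add: u_step[OF n \<omega> 2])
    \<comment> \<open>Adding the two updates absorbs the source terms of \<open>v\<close>; the
      resulting weights sum to \<open>1 + h\<close>.\<close>
    moreover have "v (Suc n) \<omega> m + u (Suc n) \<omega> m
        = mesh_ratio * (1 + b n \<omega> m) * (v n \<omega> (m + 1) + u n \<omega> (m + 1))
        + mesh_ratio * (1 - b n \<omega> m) * (v n \<omega> (m - 1) + u n \<omega> (m - 1))
        + (1 - 2 * mesh_ratio + h n \<omega> m) * (v n \<omega> m + u n \<omega> m)"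
      unfolding u_step[OF n \<omega> 2] v_step[OF n \<omega> 2] by (simp add: algebra_simps)
    moreover have "\<dots> \<in> {0..eta_tilde}"
      using p h_le[OF j(2)] h_ge[OF j(2)]
      by (intro subconvex_combination_bounds IH j) (simp_all add: algebra_simps)
    ultimately show ?thesis using c 2 by simp
  next
    case 3
    have j: "M - 1 \<le> M" "M \<le> M" by simp_all
    have "u (Suc n) \<omega> M \<in> {0..eta_tilde}"
      using subconvex_combination_bounds[OF _ _ _ _ IH(1)[OF j(2)] IH(1)[OF j(1)] IH(1)[OF j(1)],
          of "1 - 2 * mesh_ratio" "2 * mesh_ratio" 0] ratio
      by (simp add: u_right[OF n \<omega>])
    \<comment> \<open>The term with weight 0 pads the two-point boundary update to the three-term
      shape.\<close>
    moreover have "v (Suc n) \<omega> M + u (Suc n) \<omega> M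
        = 2 * mesh_ratio * (v n \<omega> (M - 1) + u n \<omega> (M - 1))
        + (1 - 2 * mesh_ratio + h n \<omega> M) * (v n \<omega> M + u n \<omega> M)
        + 0 * (v n \<omega> M + u n \<omega> M)"
      unfolding u_right[OF n \<omega>] v_right[OF n \<omega>] by (simp add: algebra_simps)
    moreover have "\<dots> \<in> {0..eta_tilde}"
      using ratio h_le[OF j(2)] h_ge[OF j(2)]
      by (intro subconvex_combination_bounds IH j) simp_all
    ultimately show ?thesis using c 3 by simp
  qed
qed

section \<open>Stability estimates\<close>

text \<open>\<open>v\<close> is the difference of \<open>v + u\<close> and \<open>u\<close>, two
  numbers in \<open>{0..eta_tilde}\<close>.\<close>

lemma abs_v_le: "\<omega> \<in> space P \<Longrightarrow> n \<le> N \<Longrightarrow> m \<le> M \<Longrightarrow> \<bar>v n \<omega> m\<bar> \<le> eta_tilde"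
  using scheme_range[of \<omega> n m] by (auto simp: abs_le_iff)

lemma norm_dx_v_le:
  assumes "\<omega> \<in> space P" "n \<le> N"
  shows "norm_dx dx M (v n \<omega>) \<le> sqrt xbar * eta_tilde"
proof -
  have "dx * real M = xbar" using mesh_positive by (simp add: dx_def)
  then show ?thesis
    using norm_dx_le[of dx eta_tilde "v n \<omega>" M] dx_pos eta_tilde_nonneg abs_v_le[OF assms]
      v_left[OF assms(2,1)] by simp
qed

lemma norm_max_v_le:
  "\<omega> \<in> space P \<Longrightarrow> n \<le> N \<Longrightarrow> norm_max M (v n \<omega>) \<le> eta_tilde"
  using mesh_positive by (intro norm_max_le abs_v_le) auto

text \<open>On a probability space a bounded measurable function is integrable, and its mean obeys
  the pathwise bound.\<close>

lemma stability_pathwise_and_mean: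
  assumes n: "n \<le> N"
  shows "(\<forall>\<omega>\<in>space P. norm_dx dx M (v n \<omega>) \<le> sqrt xbar * eta_tilde
      \<and> norm_max M (v n \<omega>) \<le> eta_tilde) \<and>
    integrable P (\<lambda>\<omega>. norm_dx dx M (v n \<omega>)) \<and>
    (\<integral>\<omega>. norm_dx dx M (v n \<omega>) \<partial>P) \<le> sqrt xbar * eta_tilde \<and>
    integrable P (\<lambda>\<omega>. norm_max M (v n \<omega>)) \<and>
    (\<integral>\<omega>. norm_max M (v n \<omega>) \<partial>P) \<le> eta_tilde"
proof -
  have meas: "(\<lambda>\<omega>. v n \<omega> m) \<in> borel_measurable P" if "m \<le> M" for m
    using borel_measurable_scheme[OF n] that by blast
  have "0 \<le> norm_dx dx M (v n \<omega>)" for \<omega>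
    unfolding norm_dx_def using dx_pos by (simp add: sum_nonneg)
  then have int_dx: "integrable P (\<lambda>\<omega>. norm_dx dx M (v n \<omega>))"
    using norm_dx_v_le[OF _ n]
    by (intro integrable_const_bound[where B = "sqrt xbar * eta_tilde"]
        borel_measurable_norm_dx meas) auto
  have int_max: "integrable P (\<lambda>\<omega>. norm_max M (v n \<omega>))"
    using norm_max_v_le[OF _ n] norm_max_nonneg mesh_positive
    by (intro integrable_const_bound[where B = eta_tilde] borel_measurable_norm_max meas) auto
  show ?thesis
    using int_dx int_max norm_dx_v_le[OF _ n] norm_max_v_le[OF _ n]
    by (auto intro!: integral_le_const)
qed

end

end

text \<open>\<open>C\<close> and \<open>C_T\<close> are chosen before the model data and the
  solution, which expresses their independence of \<open>n\<close> and \<omega>. Integrability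
  accompanies the mean bounds because the integral of a non-integrable function is 0 by
  convention.\<close>

theorem proposition4p5:
  shows "\<exists>(C :: real \<Rightarrow> real \<Rightarrow> real \<Rightarrow> real) (C_T :: real \<Rightarrow> real).
    (\<forall>\<delta> T xbar. 0 < \<delta> \<longrightarrow> 0 < T \<longrightarrow> 0 < xbar \<longrightarrow> 0 < C \<delta> T xbar) \<and>
    (\<forall>T. 0 < T \<longrightarrow> 0 < C_T T) \<and>
    (\<forall>\<alpha> \<gamma> \<sigma> \<eta> lam c0 \<phi>1 \<phi>2 k T xbar M N (P :: 'w measure) F W \<Psi> \<psi>0 s0 u v c.
       coupled_scheme \<alpha> \<gamma> \<sigma> \<eta> lam c0 \<phi>1 \<phi>2 k T xbar M N P F W \<Psi> \<psi>0 s0 u v c \<longrightarrow>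
       (let \<Delta>x = xbar / real M; \<Delta>t = T / real N; eta_tilde = \<eta> / (\<phi>1 + c0 * \<phi>2) in
          0 \<le> s0 \<longrightarrow> s0 \<le> eta_tilde \<longrightarrow>
          \<Delta>t / \<Delta>x\<^sup>2 \<le> 1 / 2 \<longrightarrow>
          c0 < 4 / 5 * (\<phi>1 / \<bar>\<phi>2\<bar>) \<longrightarrow>
          \<Delta>t \<le> \<Delta>x\<^sup>2 / (2 + lam * c0 * \<Delta>x\<^sup>2 * (1 - \<phi>2 * eta_tilde)) \<longrightarrow>
          (\<forall>n\<in>{1..N}.
             (\<forall>\<omega>\<in>space P. norm_dx \<Delta>x M (v n \<omega>) \<le> C \<Delta>x T xbar * eta_tilde
                         \<and> norm_max M (v n \<omega>) \<le> C_T T * eta_tilde) \<and>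
             integrable P (\<lambda>\<omega>. norm_dx \<Delta>x M (v n \<omega>)) \<and>
             (\<integral>\<omega>. norm_dx \<Delta>x M (v n \<omega>) \<partial>P) \<le> C \<Delta>x T xbar * eta_tilde \<and>
             integrable P (\<lambda>\<omega>. norm_max M (v n \<omega>)) \<and>
             (\<integral>\<omega>. norm_max M (v n \<omega>) \<partial>P) \<le> C_T T * eta_tilde)))"
\<comment> \<open>The first witness is the square root of the total length
  \<open>dx * real M = xbar\<close>.\<close>
proof (rule exI[of _ "\<lambda>_ _ xbar. sqrt xbar"], rule exI[of _ "\<lambda>_. 1"],
    intro conjI allI impI)
  fix \<alpha> \<gamma> \<sigma> \<eta> lam c0 \<phi>1 \<phi>2 k T xbar :: real and M N :: nat and P :: "'w measure"
    and F W \<Psi> \<psi>0 s0 u v c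
  assume scheme: "coupled_scheme \<alpha> \<gamma> \<sigma> \<eta> lam c0 \<phi>1 \<phi>2 k T xbar M N P F W \<Psi> \<psi>0 s0 u v c"
  then interpret boundary_data \<alpha> \<gamma> \<sigma> \<eta> lam c0 \<phi>1 \<phi>2 k T xbar M N P F W \<Psi> \<psi>0
    by (rule coupled_scheme.axioms(1))
  \<comment> \<open>Unfolding turns the mesh constants into the explicit quotients of the
    goal.\<close>
  note stability = coupled_scheme.stability_pathwise_and_mean[OF scheme,
      unfolded mesh_ratio_def dx_def dt_def eta_tilde_def]
  show "let \<Delta>x = xbar / real M; \<Delta>t = T / real N; eta_tilde = \<eta> / (\<phi>1 + c0 * \<phi>2) in
          0 \<le> s0 \<longrightarrow> s0 \<le> eta_tilde \<longrightarrow>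
          \<Delta>t / \<Delta>x\<^sup>2 \<le> 1 / 2 \<longrightarrow>
          c0 < 4 / 5 * (\<phi>1 / \<bar>\<phi>2\<bar>) \<longrightarrow>
          \<Delta>t \<le> \<Delta>x\<^sup>2 / (2 + lam * c0 * \<Delta>x\<^sup>2 * (1 - \<phi>2 * eta_tilde)) \<longrightarrow>
          (\<forall>n\<in>{1..N}.
             (\<forall>\<omega>\<in>space P. norm_dx \<Delta>x M (v n \<omega>) \<le> sqrt xbar * eta_tilde
                         \<and> norm_max M (v n \<omega>) \<le> 1 * eta_tilde) \<and>
             integrable P (\<lambda>\<omega>. norm_dx \<Delta>x M (v n \<omega>)) \<and>
             (\<integral>\<omega>. norm_dx \<Delta>x M (v n \<omega>) \<partial>P) \<le> sqrt xbar * eta_tilde \<and>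
             integrable P (\<lambda>\<omega>. norm_max M (v n \<omega>)) \<and>
             (\<integral>\<omega>. norm_max M (v n \<omega>) \<partial>P) \<le> 1 * eta_tilde)"
    unfolding Let_def mult_1 by (intro impI ballI stability) auto
qed simp_all

end
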